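(* Let $F:\mathbb{R}^d\to\mathbb{R}$ be twice continuously differentiable, bounded below by a scalar $\widehat F$, and have $L$-Lipschitz continuous gradient on $\mathbb{R}^d$. Let $\epsilon>0$ and let $\{w_k\}$ be the iterates generated by the sampled LSR1 (S-LSR1) trust-region method, with the modification that the Hessian approximation update is performed using only curvature pairs that satisfy $|s^T(y-Bs)|>\epsilon\|s\|^2$, and $B_k=I$ if no curvature pairs satisfy this condition. Suppose that for all $k$ the step $p_k$ satisfies $$m_k(0)-m_k(p_k)\ge\xi\|\nabla F(w_k)\|\min\left\{\frac{\|\nabla F(w_k)\|}{\beta_k},\Delta_k\right\},$$ where $\xi\in(0,1)$ and $\beta_k=1+\|B_k\|$. Then $$\lim_{k\to\infty}\|\nabla F(w_k)\|=0.$$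
   Context: S-LSR1 method with memory $m\ge1$, sampling radius $r>0$, initial trust-region radius $\Delta_0>0$, and $\eta_1\in(0,1)$. At iteration $k$, given $w_k$ and $\Delta_k$: (1) For $j=1,\dots,m$ sample a (nonzero, otherwise arbitrary) random direction $\sigma_j\in\mathbb{R}^d$, set $\bar w_j=w_k+r\sigma_j$, $s_{k,j}=w_k-\bar w_j$, and either $y_{k,j}=\nabla F(w_k)-\nabla F(\bar w_j)$ (Option I) or $y_{k,j}=\nabla^2F(w_k)s_{k,j}$ (Option II); the result holds for both options. (2) Starting from $B_k^{(0)}=\gamma_kI$ with $0\le\gamma_k<\gamma$ ($\gamma<\infty$ independent of $k$), go through the pairs in order; a pair $(s,y)$ is accepted if $|s^T(y-Bs)|>\epsilon\|s\|^2$, where $B$ is the current matrix, in which case $B$ is replaced by $B+\frac{(y-Bs)(y-Bs)^T}{(y-Bs)^Ts}$; otherwise the pair is discarded. The final matrix is $B_k$; if no pair is accepted, $B_k=I$. (3) Let $m_k(p)=F(w_k)+\nabla F(w_k)^Tp+\frac12p^TB_kp$ and let $p_k$, with $\|p_k\|\le\Delta_k$, be the (approximate) solution of $\min_p m_k(p)$ subject to $\|p\|\le\Delta_k$. (4) Let $\rho_k=\frac{F(w_k)-F(w_k+p_k)}{m_k(0)-m_k(p_k)}$. If $\rho_k\ge\eta_1$ set $w_{k+1}=w_k+p_k$, else $w_{k+1}=w_k$. (5) Radius update, with parameters $0\le\eta_3<\eta_2<1$, $\gamma_1\in(0,1)$, $\zeta_1>1$, $\zeta_2\in(0,1)$: if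 $\rho_k>\eta_2$, set $\Delta_{k+1}=\Delta_k$ when $\|p_k\|\le\gamma_1\Delta_k$ and $\Delta_{k+1}=\zeta_1\Delta_k$ otherwise; if $\eta_3\le\rho_k\le\eta_2$, set $\Delta_{k+1}=\Delta_k$; if $\rho_k<\eta_3$, set $\Delta_{k+1}=\zeta_2\Delta_k$.
   Formalization: The formal theorem adds the condition η₁ ≤ η₃ (every rejected step shrinks the radius); without it the claim is false, since a step with η₃ ≤ ρ_k < η₁ is rejected while the radius is kept, and the method can stall at a non-stationary point. *)

theory Defs
  imports "HOL-Analysis.Analysis"
begin

definition gradient :: "(real^'n \<Rightarrow> real) \<Rightarrow> real^'n \<Rightarrow> real^'n" where
  "gradient F x = (THE D. GDERIV F x :> D)"

definition hessian :: "(real^'n \<Rightarrow> real) \<Rightarrow> real^'n \<Rightarrow> real^'n^'n" where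
  "hessian F x = jacobian (gradient F) (at x)"

text \<open>Once the gradient and the Hessian exist everywhere, continuity of the Hessian gives
  continuity of the lower-order derivatives.\<close>

definition twice_continuously_differentiable :: "(real^'n \<Rightarrow> real) \<Rightarrow> bool" where
  "twice_continuously_differentiable F \<longleftrightarrow>
     (\<forall>x. F differentiable (at x)) \<and>
     (\<forall>x. gradient F differentiable (at x)) \<and>
     continuous_on UNIV (hessian F)"

lemma GDERIV_gradient:
  fixes F :: "real^'n \<Rightarrow> real"
  assumes "F differentiable (at x)"
  shows "GDERIV F x :> gradient F x"
proof -
  obtain F' where F': "(F has_derivative F') (at x)"
    using assms by (auto simp: differentiable_def)
  then have lin: "linear F'"
    by (rule has_derivative_linear)
  define D where "D = adjoint F' 1"
  have "F' h = h \<bullet> D" for h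
    using adjoint_works[OF lin, of h 1] by (simp add: D_def)
  then have "F' = (\<lambda>h. h \<bullet> D)"
    by blast
  with F' have D: "GDERIV F x :> D"
    by (simp add: gderiv_def)
  have "E = D" if "GDERIV F x :> E" for E
  proof -
    have "(\<lambda>h. h \<bullet> E) = (\<lambda>h. h \<bullet> D)"
      using that D unfolding gderiv_def by (rule has_derivative_unique)
    then have "h \<bullet> E = h \<bullet> D" for h
      by meson
    then show ?thesis
      using vector_eq_ldot[of E D] by blast
  qed
  with D show ?thesis
    unfolding gradient_def by (rule theI)
qed

lemma has_derivative_hessian:
  fixes F :: "real^'n \<Rightarrow> real"
  assumes "gradient F differentiable (at x)"
  shows "(gradient F has_derivative (\<lambda>h. hessian F x *v h)) (at x)"
  using assms unfolding hessian_def by (simp add: jacobian_works)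

text \<open>The matrix norm induced by the Euclidean norm (the instance \<open>norm\<close> on
  nested vectors is the Frobenius norm).\<close>

definition spectral_norm :: "real^'n^'n \<Rightarrow> real" where
  "spectral_norm A = onorm (\<lambda>x. A *v x)"

datatype pair_option = Option_I | Option_II

definition curvature_pair ::
  "pair_option \<Rightarrow> (real^'n \<Rightarrow> real) \<Rightarrow> real \<Rightarrow> real^'n \<Rightarrow> real^'n \<Rightarrow> (real^'n) \<times> (real^'n)" where
  "curvature_pair opt F r w \<sigma> =
     (let wbar = w + r *\<^sub>R \<sigma>; s = w - wbar in
      (s, case opt of
            Option_I \<Rightarrow> gradient F w - gradient F wbar
          | Option_II \<Rightarrow> hessian F w *v s))"

definition sr1_accept :: "real \<Rightarrow> real^'n^'n \<Rightarrow> real^'n \<Rightarrow> real^'n \<Rightarrow> bool" where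
  "sr1_accept \<epsilon> B s y \<longleftrightarrow> \<bar>s \<bullet> (y - B *v s)\<bar> > \<epsilon> * (norm s)\<^sup>2"

definition sr1_update :: "real^'n^'n \<Rightarrow> real^'n \<Rightarrow> real^'n \<Rightarrow> real^'n^'n" where
  "sr1_update B s y =
     (let v = y - B *v s in B + (1 / (v \<bullet> s)) *\<^sub>R (\<chi> i j. v $ i * v $ j))"

text \<open>The Boolean component records whether some pair has been accepted so far.\<close>

definition sr1_step ::
  "real \<Rightarrow> (real^'n^'n) \<times> bool \<Rightarrow> (real^'n) \<times> (real^'n) \<Rightarrow> (real^'n^'n) \<times> bool" where
  "sr1_step \<epsilon> = (\<lambda>(B, acc) (s, y).
     if sr1_accept \<epsilon> B s y then (sr1_update B s y, True) else (B, acc))"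

definition sr1_matrix ::
  "real \<Rightarrow> real \<Rightarrow> ((real^'n) \<times> (real^'n)) list \<Rightarrow> real^'n^'n" where
  "sr1_matrix \<epsilon> \<gamma> pairs =
     (let (B, acc) = foldl (sr1_step \<epsilon>) (mat \<gamma>, False) pairs
      in if acc then B else mat 1)"

text \<open>The sampled pairs are used in the order \<open>j = 1, \<dots>, m\<close>.\<close>

definition slsr1_matrix ::
  "pair_option \<Rightarrow> (real^'n \<Rightarrow> real) \<Rightarrow> nat \<Rightarrow> real \<Rightarrow> real \<Rightarrow> real
    \<Rightarrow> real^'n \<Rightarrow> (nat \<Rightarrow> real^'n) \<Rightarrow> real^'n^'n" where
  "slsr1_matrix opt F m r \<epsilon> \<gamma> w \<sigma> =
     sr1_matrix \<epsilon> \<gamma> (map (\<lambda>j. curvature_pair opt F r w (\<sigma> j)) [1..<Suc m])"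

definition quad_model ::
  "(real^'n \<Rightarrow> real) \<Rightarrow> real^'n^'n \<Rightarrow> real^'n \<Rightarrow> real^'n \<Rightarrow> real" where
  "quad_model F B w p = F w + gradient F w \<bullet> p + 1/2 * (p \<bullet> (B *v p))"

text \<open>If the predicted reduction is \<open>0\<close>, this ratio is \<open>0\<close>.  This can only happen at a
  stationary point when the step satisfies the sufficient decrease condition; the step is
  then rejected because the acceptance threshold is positive.\<close>

definition reduction_ratio ::
  "(real^'n \<Rightarrow> real) \<Rightarrow> real^'n^'n \<Rightarrow> real^'n \<Rightarrow> real^'n \<Rightarrow> real" where
  "reduction_ratio F B w p =
     (F w - F (w + p)) / (quad_model F B w 0 - quad_model F B w p)"

definition radius_update ::
  "real \<Rightarrow> real \<Rightarrow> real \<Rightarrow> real \<Rightarrow> real \<Rightarrow> real \<Rightarrow> real \<Rightarrow> real \<Rightarrow> real" where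
  "radius_update \<eta>2 \<eta>3 \<gamma>1 \<zeta>1 \<zeta>2 \<rho> normp \<Delta> =
     (if \<rho> > \<eta>2 then (if normp \<le> \<gamma>1 * \<Delta> then \<Delta> else \<zeta>1 * \<Delta>)
      else if \<eta>3 \<le> \<rho> then \<Delta>
      else \<zeta>2 * \<Delta>)"

text \<open>In the iteration below, \<open>\<gamma> k\<close> is the scaling of the initial matrix (distinct from the
  radius parameter \<open>\<gamma>1\<close>), and \<open>\<sigma> k j\<close> is the realisation of the \<open>j\<close>-th sampled direction at
  iteration \<open>k\<close>.\<close>

definition slsr1_run ::
  "pair_option \<Rightarrow> (real^'n \<Rightarrow> real) \<Rightarrow> nat \<Rightarrow> real \<Rightarrow> real
    \<Rightarrow> real \<Rightarrow> real \<Rightarrow> real \<Rightarrow> real \<Rightarrow> real \<Rightarrow> real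
    \<Rightarrow> (nat \<Rightarrow> real) \<Rightarrow> (nat \<Rightarrow> nat \<Rightarrow> real^'n)
    \<Rightarrow> (nat \<Rightarrow> real^'n) \<Rightarrow> (nat \<Rightarrow> real) \<Rightarrow> (nat \<Rightarrow> real^'n^'n) \<Rightarrow> (nat \<Rightarrow> real^'n) \<Rightarrow> bool" where
  "slsr1_run opt F m r \<epsilon> \<eta>1 \<eta>2 \<eta>3 \<gamma>1 \<zeta>1 \<zeta>2 \<gamma> \<sigma> w \<Delta> B p \<longleftrightarrow>
     \<Delta> 0 > 0 \<and>
     (\<forall>k. (\<forall>j\<in>{1..m}. \<sigma> k j \<noteq> 0) \<and>
          B k = slsr1_matrix opt F m r \<epsilon> (\<gamma> k) (w k) (\<sigma> k) \<and>
          norm (p k) \<le> \<Delta> k \<and>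
          (let \<rho> = reduction_ratio F (B k) (w k) (p k) in
             w (Suc k) = (if \<rho> \<ge> \<eta>1 then w k + p k else w k) \<and>
             \<Delta> (Suc k) = radius_update \<eta>2 \<eta>3 \<gamma>1 \<zeta>1 \<zeta>2 \<rho> (norm (p k)) (\<Delta> k)))"

end

theory Submission
  imports Defs
begin

text \<open>The acceptance test bounds the denominator of every SR1 update from below by
  \<open>\<epsilon> \<parallel>s\<parallel>\<^sup>2\<close>, while \<open>\<parallel>y\<parallel> \<le> L \<parallel>s\<parallel>\<close> for both kinds of pairs. One update therefore increases
  the norm of the matrix from \<open>t\<close> to at most \<open>t + (L + t)\<^sup>2 / \<epsilon>\<close>, and as each \<open>B k\<close> arises
  from at most \<open>m\<close> updates of a bounded matrix, the norms are bounded uniformly in \<open>k\<close>.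

  Consequently the model error is quadratic in the step, and while the gradient norm is at
  least \<open>\<delta>\<close>, small radii force a ratio above \<open>\<eta>2\<close>, so that the radius stays bounded away
  from 0. Infinitely many steps would then be accepted, each decreasing \<open>F\<close> by a fixed
  amount; hence the gradient norm is below \<open>\<delta>\<close> infinitely often. Along a stretch on which it
  is at least \<open>\<delta>\<close>, the distance travelled is at most a constant times the decrease of \<open>F\<close>,
  which tends to 0. By the Lipschitz condition the gradient norm cannot then fall from
  \<open>2 \<delta>\<close> to \<open>\<delta>\<close> infinitely often.\<close>

section \<open>Boundedness of the SR1 matrices\<close>

lemma spectral_norm_bound: "norm (A *v x) \<le> spectral_norm A * norm x"
  unfolding spectral_norm_def by (rule onorm) (rule matrix_vector_mul_bounded_linear)

lemma spectral_norm_nonneg: "0 \<le> spectral_norm A"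
  unfolding spectral_norm_def by (rule onorm_pos_le) (rule matrix_vector_mul_bounded_linear)

lemma spectral_norm_leI:
  assumes "\<And>x. norm (A *v x) \<le> c * norm x"
  shows "spectral_norm A \<le> c"
  unfolding spectral_norm_def using assms by (rule onorm_le)

lemma spectral_norm_mat: "spectral_norm (mat c :: real^'n^'n) \<le> \<bar>c\<bar>"
proof (rule spectral_norm_leI)
  fix x :: "real^'n"
  have "mat c *v x = c *\<^sub>R x"
    by (simp add: vec_eq_iff matrix_vector_mult_def mat_def if_distrib if_distribR cong: if_cong)
  then show "norm (mat c *v x) \<le> \<bar>c\<bar> * norm x"
    by simp
qed

lemma outer_product_mult_vec:
  fixes v x :: "real^'n"
  shows "(\<chi> i j. v $ i * v $ j) *v x = (v \<bullet> x) *\<^sub>R v"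
  by (simp add: vec_eq_iff matrix_vector_mult_def inner_vec_def sum_distrib_left
      sum_distrib_right mult_ac)

lemma sr1_update_mult_vec:
  "sr1_update B s y *v x
     = B *v x + (((y - B *v s) \<bullet> x) / ((y - B *v s) \<bullet> s)) *\<^sub>R (y - B *v s)"
  unfolding sr1_update_def Let_def matrix_vector_mult_add_rdistrib
    scaleR_matrix_vector_assoc[symmetric] outer_product_mult_vec by simp

text \<open>The correction has rank one and operator norm |v|^2 / |v . s| with v = y - B s. Its
  numerator is at most ((L + t) |s|)^2 and its denominator exceeds \<epsilon> |s|^2, so the length
  of s cancels.\<close>

lemma spectral_norm_sr1_update_le:
  fixes B :: "real^'n^'n"
  assumes acc: "sr1_accept \<epsilon> B s y" and eps: "\<epsilon> > 0" and L: "0 \<le> L"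
    and y: "norm y \<le> L * norm s" and B: "spectral_norm B \<le> t"
  shows "spectral_norm (sr1_update B s y) \<le> t + (L + t)\<^sup>2 / \<epsilon>"
proof (rule spectral_norm_leI)
  fix x :: "real^'n"
  define v where "v = y - B *v s"
  have den: "\<bar>v \<bullet> s\<bar> > \<epsilon> * (norm s)\<^sup>2"
    using acc by (simp add: sr1_accept_def v_def inner_commute)
  \<comment> \<open>For s = 0 the strict inequality \<open>den\<close> would read 0 > 0.\<close>
  then have s: "0 < norm s"
    by auto
  have t: "0 \<le> t"
    using spectral_norm_nonneg[of B] B by linarith
  have "norm (B *v s) \<le> t * norm s"
    using spectral_norm_bound[of B s] B mult_right_mono[OF B norm_ge_zero[of s]] by linarith
  then have "norm v \<le> (L + t) * norm s"
    using norm_triangle_ineq4[of y "B *v s"] y by (simp add: v_def algebra_simps)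
  then have "(norm v)\<^sup>2 \<le> (L + t)\<^sup>2 * (norm s)\<^sup>2"
    by (metis norm_ge_zero power_mono power_mult_distrib)
  then have "(norm v)\<^sup>2 / \<bar>v \<bullet> s\<bar> \<le> ((L + t)\<^sup>2 * (norm s)\<^sup>2) / (\<epsilon> * (norm s)\<^sup>2)"
    using den eps s by (intro frac_le) auto
  then have quot: "(norm v)\<^sup>2 / \<bar>v \<bullet> s\<bar> \<le> (L + t)\<^sup>2 / \<epsilon>"
    using s by simp
  have "norm (((v \<bullet> x) / (v \<bullet> s)) *\<^sub>R v) = \<bar>v \<bullet> x\<bar> * norm v / \<bar>v \<bullet> s\<bar>"
    by simp
  also have "\<dots> \<le> (norm v * norm x) * norm v / \<bar>v \<bullet> s\<bar>"
    by (intro divide_right_mono mult_right_mono Cauchy_Schwarz_ineq2) auto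
  also have "\<dots> = (norm v)\<^sup>2 / \<bar>v \<bullet> s\<bar> * norm x"
    by (simp add: power2_eq_square)
  also have "\<dots> \<le> (L + t)\<^sup>2 / \<epsilon> * norm x"
    using quot by (rule mult_right_mono) simp
  finally have "norm (((v \<bullet> x) / (v \<bullet> s)) *\<^sub>R v) \<le> (L + t)\<^sup>2 / \<epsilon> * norm x" .
  moreover have "norm (B *v x) \<le> t * norm x"
    using spectral_norm_bound[of B x] mult_right_mono[OF B norm_ge_zero[of x]] by linarith
  ultimately show "norm (sr1_update B s y *v x) \<le> (t + (L + t)\<^sup>2 / \<epsilon>) * norm x"
    unfolding sr1_update_mult_vec v_def[symmetric] distrib_right
    by (intro order_trans[OF norm_triangle_ineq] add_mono)
qed

lemma spectral_norm_foldl_sr1_step_le: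
  assumes eps: "\<epsilon> > 0" and L: "0 \<le> L"
    and pairs: "\<And>s y. (s, y) \<in> set ps \<Longrightarrow> norm y \<le> L * norm s"
    and st: "spectral_norm (fst st) \<le> t"
  shows "spectral_norm (fst (foldl (sr1_step \<epsilon>) st ps))
           \<le> ((\<lambda>t. t + (L + t)\<^sup>2 / \<epsilon>) ^^ length ps) t"
  using pairs st
proof (induction ps arbitrary: st t)
  case Nil
  then show ?case by simp
next
  case (Cons q ps)
  obtain s y where q: "q = (s, y)" by fastforce
  obtain B acc where B: "st = (B, acc)" by fastforce
  \<comment> \<open>This handles a discarded pair: the matrix stays and t is at most the new bound.
    Hence the iterations can count all pairs and not only the accepted ones.\<close>
  have "0 \<le> (L + t)\<^sup>2 / \<epsilon>"
    using eps by simp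
  moreover have "norm y \<le> L * norm s"
    using Cons.prems(1) q by simp
  ultimately have "spectral_norm (fst (sr1_step \<epsilon> st q)) \<le> t + (L + t)\<^sup>2 / \<epsilon>"
    using Cons.prems(2) spectral_norm_sr1_update_le[OF _ eps L, of B s y t]
    by (auto simp: q B sr1_step_def)
  with Cons.IH[of "sr1_step \<epsilon> st q"] Cons.prems(1) show ?case
    by (simp add: funpow_Suc_right del: funpow.simps)
qed

section \<open>Curvature pairs and the matrices built from them\<close>

lemma has_derivative_lipschitz_norm_le:
  fixes f :: "'a::real_normed_vector \<Rightarrow> 'b::real_normed_vector"
  assumes der: "(f has_derivative f') (at x)" and lip: "L-lipschitz_on UNIV f"
  shows "norm (f' h) \<le> L * norm h"
proof -
  have "((\<lambda>t. f (x + t *\<^sub>R h)) has_derivative (\<lambda>t. f' (t *\<^sub>R h))) (at 0)"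
  proof (rule has_derivative_compose[where f = "\<lambda>t. x + t *\<^sub>R h"])
    show "((\<lambda>t. x + t *\<^sub>R h) has_derivative (\<lambda>t. t *\<^sub>R h)) (at 0)"
      by (auto intro!: derivative_eq_intros)
  qed (use der in simp)
  then have "((\<lambda>t. norm (f (x + t *\<^sub>R h) - f x - t *\<^sub>R f' h) / norm t) \<longlongrightarrow> 0) (at 0)"
    using linear_cmul[OF has_derivative_linear[OF der]] by (simp add: has_derivative_at)
  \<comment> \<open>The quotient tends to 0 but is bounded below by a constant near 0, so this
    constant cannot be positive.\<close>
  moreover have "\<forall>\<^sub>F t in at 0.
      norm (f' h) - L * norm h \<le> norm (f (x + t *\<^sub>R h) - f x - t *\<^sub>R f' h) / norm t"
  proof (rule eventually_at_filter[THEN iffD2, OF always_eventually], intro allI impI)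
    fix t :: real
    assume "t \<noteq> 0"
    have "norm (t *\<^sub>R f' h) \<le> norm (f (x + t *\<^sub>R h) - f x)
        + norm (f (x + t *\<^sub>R h) - f x - t *\<^sub>R f' h)"
      using norm_triangle_ineq4[of "f (x + t *\<^sub>R h) - f x" "f (x + t *\<^sub>R h) - f x - t *\<^sub>R f' h"]
      by simp
    moreover have "norm (f (x + t *\<^sub>R h) - f x) \<le> L * (\<bar>t\<bar> * norm h)"
      using lipschitz_on_normD[OF lip, of "x + t *\<^sub>R h" x] by simp
    ultimately show "norm (f' h) - L * norm h
        \<le> norm (f (x + t *\<^sub>R h) - f x - t *\<^sub>R f' h) / norm t"
      using \<open>t \<noteq> 0\<close> by (simp add: field_simps)
  qed
  ultimately have "norm (f' h) - L * norm h \<le> 0"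
    by (rule tendsto_lowerbound) simp
  then show ?thesis by simp
qed

lemma curvature_pair_norm_le:
  fixes F :: "real^'n \<Rightarrow> real"
  assumes "twice_continuously_differentiable F" and lip: "L-lipschitz_on UNIV (gradient F)"
    and pair: "curvature_pair opt F r w \<sigma> = (s, y)"
  shows "norm y \<le> L * norm s"
proof (cases opt)
  case Option_I
  then show ?thesis
    using pair lipschitz_on_normD[OF lip, of w "w + r *\<^sub>R \<sigma>"]
    by (auto simp: curvature_pair_def Let_def)
next
  case Option_II
  have "(gradient F has_derivative (\<lambda>h. hessian F w *v h)) (at w)"
    using assms(1) by (intro has_derivative_hessian)
      (simp add: twice_continuously_differentiable_def)
  from has_derivative_lipschitz_norm_le[OF this lip] Option_II pair show ?thesis
    by (auto simp: curvature_pair_def Let_def)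
qed

text \<open>The maximum with 1 covers the fallback to the identity. The bound involves neither the
  iterate nor the sampled directions, which makes it uniform over the iterations.\<close>

lemma spectral_norm_slsr1_matrix_le:
  fixes F :: "real^'n \<Rightarrow> real"
  assumes smooth: "twice_continuously_differentiable F"
    and lip: "L-lipschitz_on UNIV (gradient F)"
    and eps: "\<epsilon> > 0" and \<gamma>: "\<bar>\<gamma>\<bar> \<le> c"
  shows "spectral_norm (slsr1_matrix opt F m r \<epsilon> \<gamma> w \<sigma>)
           \<le> max 1 (((\<lambda>t. t + (L + t)\<^sup>2 / \<epsilon>) ^^ m) c)"
proof -
  define ps where "ps = map (\<lambda>j. curvature_pair opt F r w (\<sigma> j)) [1..<Suc m]"
  have "norm y \<le> L * norm s" if "(s, y) \<in> set ps" for s y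
    using that by (auto simp: ps_def dest!: sym[of "(s, y)"]
        intro: curvature_pair_norm_le[OF smooth lip])
  moreover have "spectral_norm (mat \<gamma> :: real^'n^'n) \<le> c"
    using spectral_norm_mat[of \<gamma>] \<gamma> by (rule order_trans)
  ultimately have "spectral_norm (fst (foldl (sr1_step \<epsilon>) (mat \<gamma>, False) ps))
      \<le> ((\<lambda>t. t + (L + t)\<^sup>2 / \<epsilon>) ^^ length ps) c"
    using spectral_norm_foldl_sr1_step_le[OF eps lipschitz_on_nonneg[OF lip], of ps "(mat \<gamma>, False)"]
    by simp
  moreover have "length ps = m"
    by (simp add: ps_def)
  moreover have "spectral_norm (mat 1 :: real^'n^'n) \<le> 1"
    using spectral_norm_mat[of 1] by simp
  ultimately show ?thesis
    unfolding slsr1_matrix_def ps_def[symmetric] sr1_matrix_def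
    by (auto simp: Let_def split: prod.split)
qed

section \<open>Trust-region convergence under a quadratic model error\<close>

text \<open>The mean value theorem on the segment gives the constant L in place of the sharper L/2;
  only the quadratic order in h matters later.\<close>

lemma linearization_error_le:
  fixes F :: "'a::real_inner \<Rightarrow> real"
  assumes der: "\<And>x. GDERIV F x :> G x" and lip: "L-lipschitz_on UNIV G"
  shows "\<bar>F (x + h) - F x - G x \<bullet> h\<bar> \<le> L * (norm h)\<^sup>2"
proof -
  have comp: "((\<lambda>t. F (x + t *\<^sub>R h)) has_derivative (\<lambda>u. (u *\<^sub>R h) \<bullet> G (x + t *\<^sub>R h))) (at t)"
    for t :: real
  proof (rule has_derivative_compose[where f = "\<lambda>t. x + t *\<^sub>R h"])
    show "((\<lambda>t. x + t *\<^sub>R h) has_derivative (\<lambda>t. t *\<^sub>R h)) (at t)"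
      by (auto intro!: derivative_eq_intros)
  qed (use der[of "x + t *\<^sub>R h"] in \<open>simp add: gderiv_def\<close>)
  then have "continuous_on {0..1} (\<lambda>t. F (x + t *\<^sub>R h))"
    by (intro continuous_at_imp_continuous_on ballI) (rule has_derivative_continuous)
  from mvt[OF zero_less_one this comp] obtain t where t: "0 < t" "t < 1"
    and eq: "F (x + 1 *\<^sub>R h) - F (x + 0 *\<^sub>R h) = ((1 - 0) *\<^sub>R h) \<bullet> G (x + t *\<^sub>R h)"
    by blast
  have "\<bar>F (x + h) - F x - G x \<bullet> h\<bar> = \<bar>h \<bullet> (G (x + t *\<^sub>R h) - G x)\<bar>"
    using eq by (simp add: inner_diff_right inner_commute)
  also have "\<dots> \<le> norm h * norm (G (x + t *\<^sub>R h) - G x)"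
    by (rule Cauchy_Schwarz_ineq2)
  also have "norm (G (x + t *\<^sub>R h) - G x) \<le> L * (t * norm h)"
    using lipschitz_on_normD[OF lip, of "x + t *\<^sub>R h" x] t by simp
  also have "\<dots> \<le> L * (1 * norm h)"
    using t lipschitz_on_nonneg[OF lip] by (intro mult_left_mono mult_right_mono) auto
  finally show ?thesis
    by (simp add: power2_eq_square mult_left_mono mult.left_commute)
qed

text \<open>The linear terms of F and of the model cancel, which leaves the linearization error and
  half the quadratic form of B.\<close>

lemma quad_model_error_le:
  fixes F :: "real^'n \<Rightarrow> real"
  assumes der: "\<And>x. GDERIV F x :> gradient F x" and lip: "L-lipschitz_on UNIV (gradient F)"
    and b: "spectral_norm B \<le> b"
  shows "\<bar>F w - F (w + p) - (quad_model F B w 0 - quad_model F B w p)\<bar> \<le> (L + b) * (norm p)\<^sup>2"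
proof -
  have "\<bar>p \<bullet> (B *v p)\<bar> \<le> norm p * norm (B *v p)"
    by (rule Cauchy_Schwarz_ineq2)
  also have "\<dots> \<le> norm p * (b * norm p)"
    using spectral_norm_bound[of B p] mult_right_mono[OF b norm_ge_zero[of p]]
    by (intro mult_left_mono) auto
  finally have "\<bar>p \<bullet> (B *v p)\<bar> \<le> b * (norm p)\<^sup>2"
    by (simp add: power2_eq_square mult_ac)
  with linearization_error_le[OF der lip, of w p] show ?thesis
    by (simp add: quad_model_def algebra_simps)
qed

text \<open>The matrices survive only in constants: \<beta> stands for a uniform bound on 1 + |B k|,
  and \<open>C\<close> for the constant of the model error. The predicted reduction
  \<open>pred\<close> is the link between \<open>G\<close> and \<open>F\<close>.\<close>

locale trust_region_iteration =
  fixes F :: "'a::real_normed_vector \<Rightarrow> real" and G :: "'a \<Rightarrow> 'a"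
    and w p :: "nat \<Rightarrow> 'a" and \<Delta> pred \<rho> :: "nat \<Rightarrow> real"
    and Fhat L C \<beta> \<xi> \<eta>1 \<eta>2 \<eta>3 \<gamma>1 \<zeta>1 \<zeta>2 :: real
  assumes bounded_below: "\<And>x. Fhat \<le> F x"
    and lipschitz: "L-lipschitz_on UNIV G"
    and params: "0 < C" "0 < \<beta>" "0 < \<xi>" "0 < \<eta>1" "\<eta>1 \<le> \<eta>3" "\<eta>3 < \<eta>2" "\<eta>2 < 1"
      "1 < \<zeta>1" "0 < \<zeta>2" "\<zeta>2 < 1"
    and radius_0: "0 < \<Delta> 0"
    and step_le: "\<And>k. norm (p k) \<le> \<Delta> k"
    and ratio: "\<And>k. \<rho> k = (F (w k) - F (w k + p k)) / pred k"
    and w_Suc: "\<And>k. w (Suc k) = (if \<rho> k \<ge> \<eta>1 then w k + p k else w k)"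
    and radius_Suc: "\<And>k. \<Delta> (Suc k) = radius_update \<eta>2 \<eta>3 \<gamma>1 \<zeta>1 \<zeta>2 (\<rho> k) (norm (p k)) (\<Delta> k)"
    and pred_ge: "\<And>k. \<xi> * norm (G (w k)) * min (norm (G (w k)) / \<beta>) (\<Delta> k) \<le> pred k"
    and model_error: "\<And>k. \<bar>F (w k) - F (w k + p k) - pred k\<bar> \<le> C * (norm (p k))\<^sup>2"
begin

section \<open>Predicted reductions and the monotone decrease of the objective\<close>

lemma radius_pos: "0 < \<Delta> k"
  by (induction k) (use radius_0 params in \<open>auto simp: radius_Suc radius_update_def\<close>)

lemma pred_ge_of_gradient_ge:
  assumes "\<delta> > 0" "\<delta> \<le> norm (G (w k))"
  shows "\<xi> * \<delta> * min (\<delta> / \<beta>) (\<Delta> k) \<le> pred k"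
proof -
  have "\<xi> * \<delta> * min (\<delta> / \<beta>) (\<Delta> k) \<le> \<xi> * norm (G (w k)) * min (norm (G (w k)) / \<beta>) (\<Delta> k)"
    using assms params radius_pos[of k]
    by (intro mult_mono min.mono divide_right_mono) auto
  with pred_ge[of k] show ?thesis by linarith
qed

lemma pred_nonneg: "0 \<le> pred k"
proof -
  have "0 \<le> \<xi> * norm (G (w k)) * min (norm (G (w k)) / \<beta>) (\<Delta> k)"
    using params radius_pos[of k] by (intro mult_nonneg_nonneg) auto
  with pred_ge[of k] show ?thesis by linarith
qed

lemma decrease_if_accepted:
  assumes "\<eta>1 \<le> \<rho> k"
  shows "\<eta>1 * pred k \<le> F (w k) - F (w (Suc k))"
proof -
  \<comment> \<open>Division by 0 yields 0, so a vanishing prediction would give the ratio 0, below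
    \<eta>1.\<close>
  have "pred k \<noteq> 0"
    using assms params ratio[of k] by auto
  with pred_nonneg[of k] have "0 < pred k" by simp
  with assms show ?thesis
    by (simp add: ratio w_Suc pos_le_divide_eq)
qed

lemma decseq_F: "decseq (\<lambda>k. F (w k))"
proof (rule decseq_SucI)
  fix k
  show "F (w (Suc k)) \<le> F (w k)"
  proof (cases "\<eta>1 \<le> \<rho> k")
    case True
    have "0 \<le> \<eta>1 * pred k"
      using pred_nonneg[of k] params by simp
    with decrease_if_accepted[OF True] show ?thesis by linarith
  qed (simp add: w_Suc)
qed

text \<open>The decreasing values converge to a limit below all of them; once they are within e of
  it, no later stretch can decrease F by e.\<close>

lemma eventually_F_close:
  assumes "0 < e"
  obtains K where "\<And>k l. K \<le> k \<Longrightarrow> k \<le> l \<Longrightarrow> F (w k) - F (w l) < e"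
proof -
  obtain M where M: "(\<lambda>k. F (w k)) \<longlonglongrightarrow> M" and ge: "\<And>k. M \<le> F (w k)"
    using decseq_convergent[OF decseq_F, of Fhat] bounded_below by blast
  from order_tendstoD(2)[OF M, of "M + e"] assms obtain K where "\<forall>k\<ge>K. F (w k) < M + e"
    by (auto simp: eventually_sequentially)
  with ge have "F (w k) - F (w l) < e" if "K \<le> k" for k l
    using that by (smt (verit))
  then show thesis using that by blast
qed

text \<open>The model error is at most C \<Delta>^2, while the predicted reduction is at least \<xi>
  \<delta> \<Delta>, linear in the radius. Below the threshold the error is less than the fraction 1
  - \<eta>2 of the prediction.\<close>

lemma ratio_gt_if_radius_small:
  assumes "\<delta> > 0" "\<delta> \<le> norm (G (w k))" "\<Delta> k \<le> \<delta> / \<beta>" "\<Delta> k < (1 - \<eta>2) * \<xi> * \<delta> / C"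
  shows "\<eta>2 < \<rho> k"
proof -
  have pred: "\<xi> * \<delta> * \<Delta> k \<le> pred k"
    using pred_ge_of_gradient_ge[OF assms(1,2)] assms(3) by (simp add: min_absorb2)
  have pos: "0 < \<xi> * \<delta> * \<Delta> k"
    using params assms(1) radius_pos[of k] by simp
  have "C * (norm (p k))\<^sup>2 \<le> C * (\<Delta> k)\<^sup>2"
    using step_le[of k] params by (intro mult_left_mono power_mono) auto
  also have "\<dots> = (C * \<Delta> k) * \<Delta> k"
    by (simp add: power2_eq_square)
  also have "\<dots> < ((1 - \<eta>2) * \<xi> * \<delta>) * \<Delta> k"
    using assms(4) params radius_pos[of k] by (intro mult_strict_right_mono) (auto simp: field_simps)
  also have "\<dots> = (1 - \<eta>2) * (\<xi> * \<delta> * \<Delta> k)"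
    by simp
  also have "\<dots> \<le> (1 - \<eta>2) * pred k"
    using pred params by (intro mult_left_mono) auto
  finally have "\<eta>2 * pred k < F (w k) - F (w k + p k)"
    using model_error[of k] by (simp add: algebra_simps abs_le_iff)
  then show ?thesis
    using pred pos by (simp add: ratio pos_less_divide_eq)
qed

section \<open>From small gradients infinitely often to convergence\<close>

lemma gradient_small_frequently:
  assumes "\<delta> > 0"
  shows "\<exists>k\<ge>K. norm (G (w k)) < \<delta>"
proof (rule ccontr)
  assume "\<not> ?thesis"
  then have large: "\<delta> \<le> norm (G (w k))" if "K \<le> k" for k
    using that by (auto simp: not_less)
  have "0 < min (\<delta> / \<beta>) ((1 - \<eta>2) * \<xi> * \<delta> / C)"
    using assms params by simp
  \<comment> \<open>Radii up to D meet both conditions of \<open>ratio_gt_if_radius_small\<close>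
    and hence do not shrink.\<close>
  then obtain D where D: "0 < D" "D < \<delta> / \<beta>" "D < (1 - \<eta>2) * \<xi> * \<delta> / C"
    using dense by (meson min_less_iff_conj)
  \<comment> \<open>From K on, a radius shrinks only from a value above D, and then by the factor
    \<zeta>2.\<close>
  define m where "m = min (\<Delta> K) (\<zeta>2 * D)"
  have m: "0 < m"
    using D params radius_pos[of K] by (simp add: m_def)
  have radius_ge: "m \<le> \<Delta> k" if "K \<le> k" for k
    using that
  proof (induction k rule: dec_induct)
    case base
    then show ?case by (simp add: m_def)
  next
    case (step k)
    show ?case
    proof (cases "\<eta>3 \<le> \<rho> k")
      case True
      then have "\<Delta> k \<le> \<Delta> (Suc k)"
        using params radius_pos[of k] by (auto simp: radius_Suc radius_update_def)
      with step.IH show ?thesis by simp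
    next
      case False
      then have "D < \<Delta> k"
        using ratio_gt_if_radius_small[OF assms large, of k] step.hyps D params by force
      then have "\<zeta>2 * D \<le> \<zeta>2 * \<Delta> k"
        using params by simp
      with False show ?thesis
        using params by (simp add: radius_Suc radius_update_def m_def min.coboundedI2)
    qed
  qed
  \<comment> \<open>Every step accepted from K on decreases F by at least c, so a tail whose total
    decrease is below c contains none.\<close>
  define c where "c = \<eta>1 * (\<xi> * \<delta> * min (\<delta> / \<beta>) m)"
  have c: "0 < c"
    using assms params m by (simp add: c_def)
  then obtain K' where K': "\<And>k l. K' \<le> k \<Longrightarrow> k \<le> l \<Longrightarrow> F (w k) - F (w l) < c"
    using eventually_F_close by blast
  define N where "N = max K K'"
  have rejected: "\<rho> k < \<eta>1" if "N \<le> k" for k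
  proof (rule ccontr)
    assume "\<not> ?thesis"
    then have "\<eta>1 * pred k \<le> F (w k) - F (w (Suc k))"
      by (intro decrease_if_accepted) simp
    moreover have "\<xi> * \<delta> * min (\<delta> / \<beta>) m \<le> \<xi> * \<delta> * min (\<delta> / \<beta>) (\<Delta> k)"
      using assms params radius_ge[of k] that
      by (intro mult_left_mono min.mono) (auto simp: N_def)
    then have "\<xi> * \<delta> * min (\<delta> / \<beta>) m \<le> pred k"
      using pred_ge_of_gradient_ge[OF assms large, of k] that by (simp add: N_def)
    then have "c \<le> \<eta>1 * pred k"
      unfolding c_def using params by (intro mult_left_mono) auto
    ultimately show False
      using K'[of k "Suc k"] that by (simp add: N_def)
  qed
  \<comment> \<open>Here \<eta>1 \<le> \<eta>3 enters: each rejected step shrinks the radius. The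
    radii decay geometrically, against the lower bound m.\<close>
  have "\<Delta> (N + j) = \<zeta>2 ^ j * \<Delta> N" for j
  proof (induction j)
    case (Suc j)
    then show ?case
      using rejected[of "N + j"] params by (simp add: radius_Suc radius_update_def)
  qed simp
  then have "m \<le> \<zeta>2 ^ j * \<Delta> N" for j
    using radius_ge[of "N + j"] by (simp add: N_def)
  moreover have "(\<lambda>j. \<zeta>2 ^ j * \<Delta> N) \<longlonglongrightarrow> 0"
    using LIMSEQ_realpow_zero[of \<zeta>2] params by (auto intro!: tendsto_mult_left_zero)
  ultimately have "m \<le> 0"
    by (intro LIMSEQ_le_const) auto
  with m show False by simp
qed

theorem gradient_tendsto_zero: "(\<lambda>k. norm (G (w k))) \<longlonglongrightarrow> 0"
proof (rule LIMSEQ_I)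
  fix e :: real
  assume "0 < e"
  \<comment> \<open>One half bounds the gradient norm at a later index \<open>l\<close>, the other
    its change between \<open>k\<close> and \<open>l\<close>.\<close>
  define \<delta> where "\<delta> = e / 2"
  have \<delta>: "0 < \<delta>" using \<open>0 < e\<close> by (simp add: \<delta>_def)
  define c where "c = \<eta>1 * \<xi> * \<delta>"
  have c: "0 < c" using \<delta> params by (simp add: c_def)
  have L: "0 \<le> L" using lipschitz by (rule lipschitz_on_nonneg)
  \<comment> \<open>The first term forces the minimum in the predicted reduction to be the radius;
    the second limits the distance travelled to \<delta> / (L + 1), where adding 1 avoids division
    by 0.\<close>
  define d where "d = min (c * (\<delta> / \<beta>)) (c * (\<delta> / (L + 1)))"
  have "0 < d" using \<delta> c params L by (simp add: d_def)
  then obtain K where K: "\<And>k l. K \<le> k \<Longrightarrow> k \<le> l \<Longrightarrow> F (w k) - F (w l) < d"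
    using eventually_F_close by blast
  have travelled: "c * norm (w (Suc k) - w k) \<le> F (w k) - F (w (Suc k))"
    if "K \<le> k" "\<delta> \<le> norm (G (w k))" for k
  proof (cases "\<eta>1 \<le> \<rho> k")
    case True
    have "c * min (\<delta> / \<beta>) (\<Delta> k) \<le> \<eta>1 * pred k"
      using pred_ge_of_gradient_ge[OF \<delta> that(2)] params by (simp add: c_def mult.assoc)
    also have "\<dots> \<le> F (w k) - F (w (Suc k))"
      using True by (rule decrease_if_accepted)
    finally have *: "c * min (\<delta> / \<beta>) (\<Delta> k) \<le> F (w k) - F (w (Suc k))" .
    \<comment> \<open>The decrease is too small for the minimum to equal \<delta> / \<beta>; it is
      therefore the radius, which bounds the step.\<close>
    also have "\<dots> < c * (\<delta> / \<beta>)"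
      using K[of k "Suc k"] that(1) by (simp add: d_def)
    finally have "min (\<delta> / \<beta>) (\<Delta> k) < \<delta> / \<beta>"
      using c by (simp only: mult_less_cancel_left_pos)
    then have "min (\<delta> / \<beta>) (\<Delta> k) = \<Delta> k"
      by linarith
    with * have "c * \<Delta> k \<le> F (w k) - F (w (Suc k))"
      by simp
    moreover have "c * norm (p k) \<le> c * \<Delta> k"
      using step_le[of k] c by simp
    ultimately show ?thesis
      using True by (simp add: w_Suc)
  qed (simp add: w_Suc)
  have "norm (G (w k)) < e" if "K \<le> k" for k
  proof (cases "norm (G (w k)) < \<delta>")
    case True
    with \<delta> show ?thesis by (simp add: \<delta>_def)
  next
    case False
    \<comment> \<open>With the first such index, the gradient is large at all earlier ones from
      \<open>k\<close> on, so \<open>travelled\<close> can be summed up to \<open>l\<close>.\<close>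
    define l where "l = (LEAST l. k \<le> l \<and> norm (G (w l)) < \<delta>)"
    have ex: "\<exists>l. k \<le> l \<and> norm (G (w l)) < \<delta>"
      using gradient_small_frequently[OF \<delta>] by blast
    then have l: "k \<le> l" "norm (G (w l)) < \<delta>"
      using LeastI_ex[OF ex] by (auto simp: l_def)
    have before: "\<delta> \<le> norm (G (w i))" if "k \<le> i" "i < l" for i
      using not_less_Least[of i "\<lambda>l. k \<le> l \<and> norm (G (w l)) < \<delta>"] that by (auto simp: l_def)
    have "c * norm (w i - w k) \<le> F (w k) - F (w i)" if "k \<le> i" "i \<le> l" for i
      using that
    proof (induction i rule: dec_induct)
      case base
      then show ?case by simp
    next
      case (step i)
      have "norm (w (Suc i) - w k) \<le> norm (w (Suc i) - w i) + norm (w i - w k)"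
        using norm_triangle_ineq[of "w (Suc i) - w i" "w i - w k"] by simp
      then have "c * norm (w (Suc i) - w k) \<le> c * norm (w (Suc i) - w i) + c * norm (w i - w k)"
        using c by (simp flip: distrib_left)
      with step \<open>K \<le> k\<close> before[of i] travelled[of i] show ?case
        by simp
    qed
    from this[of l] l K[of k l] \<open>K \<le> k\<close> have "c * norm (w l - w k) < c * (\<delta> / (L + 1))"
      by (simp add: d_def)
    then have "norm (w l - w k) < \<delta> / (L + 1)"
      using c by (simp only: mult_less_cancel_left_pos)
    then have "(L + 1) * norm (w l - w k) < \<delta>"
      using L by (simp add: field_simps)
    moreover have "norm (G (w l) - G (w k)) \<le> L * norm (w l - w k)"
      using lipschitz by (rule lipschitz_on_normD) auto
    ultimately have "norm (G (w l) - G (w k)) < \<delta>"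
      using norm_ge_zero[of "w l - w k"] unfolding distrib_right by linarith
    then show ?thesis
      using norm_triangle_ineq3[of "G (w l)" "G (w k)"] l(2) by (simp add: \<delta>_def)
  qed
  then show "\<exists>K. \<forall>k\<ge>K. norm (norm (G (w k)) - 0) < e"
    by auto
qed

end

section \<open>The sampled SR1 method as a trust-region iteration\<close>

theorem theorem5p9:
  fixes F :: "real^'n \<Rightarrow> real"
    and Fhat L r \<epsilon> \<xi> \<eta>1 \<eta>2 \<eta>3 \<gamma>1 \<zeta>1 \<zeta>2 \<gamma>bound :: real
    and m :: nat
    and opt :: pair_option
    and \<gamma> :: "nat \<Rightarrow> real"
    and \<sigma> :: "nat \<Rightarrow> nat \<Rightarrow> real^'n"
    and w p :: "nat \<Rightarrow> real^'n"
    and \<Delta> :: "nat \<Rightarrow> real"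
    and B :: "nat \<Rightarrow> real^'n^'n"
  assumes smooth: "twice_continuously_differentiable F"
    and bounded_below: "\<And>x. Fhat \<le> F x"
    and lipschitz: "L-lipschitz_on UNIV (gradient F)"
    and memory: "m \<ge> 1"
    and sampling_radius: "r > 0"
    and eps: "\<epsilon> > 0"
    and xi: "0 < \<xi>" "\<xi> < 1"
    and eta1: "0 < \<eta>1" "\<eta>1 < 1"
    and eta23: "0 \<le> \<eta>3" "\<eta>3 < \<eta>2" "\<eta>2 < 1"
    and eta13: "\<eta>1 \<le> \<eta>3"
    and gamma1: "0 < \<gamma>1" "\<gamma>1 < 1"
    and zeta1: "\<zeta>1 > 1"
    and zeta2: "0 < \<zeta>2" "\<zeta>2 < 1"
    and gamma: "\<And>k. 0 \<le> \<gamma> k" "\<And>k. \<gamma> k < \<gamma>bound"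
    and run: "slsr1_run opt F m r \<epsilon> \<eta>1 \<eta>2 \<eta>3 \<gamma>1 \<zeta>1 \<zeta>2 \<gamma> \<sigma> w \<Delta> B p"
    and sufficient_decrease:
      "\<And>k. quad_model F (B k) (w k) 0 - quad_model F (B k) (w k) (p k)
         \<ge> \<xi> * norm (gradient F (w k))
             * min (norm (gradient F (w k)) / (1 + spectral_norm (B k))) (\<Delta> k)"
  shows "(\<lambda>k. norm (gradient F (w k))) \<longlonglongrightarrow> 0"
proof -
  define b where "b = max 1 (((\<lambda>t. t + (L + t)\<^sup>2 / \<epsilon>) ^^ m) \<gamma>bound)"
  have L: "0 \<le> L"
    using lipschitz by (rule lipschitz_on_nonneg)
  have der: "GDERIV F x :> gradient F x" for x
    using smooth by (intro GDERIV_gradient) (simp add: twice_continuously_differentiable_def)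
  have B: "spectral_norm (B k) \<le> b" for k
    using run gamma[of k] spectral_norm_slsr1_matrix_le[OF smooth lipschitz eps, of "\<gamma> k" \<gamma>bound]
    by (simp add: slsr1_run_def b_def)
  interpret trust_region_iteration F "gradient F" w p \<Delta>
    "\<lambda>k. quad_model F (B k) (w k) 0 - quad_model F (B k) (w k) (p k)"
    "\<lambda>k. reduction_ratio F (B k) (w k) (p k)"
    Fhat L "L + b" "1 + b" \<xi> \<eta>1 \<eta>2 \<eta>3 \<gamma>1 \<zeta>1 \<zeta>2
  proof
    fix k
    \<comment> \<open>Replacing the norm of each matrix by the uniform bound only weakens the
      sufficient decrease condition.\<close>
    have "norm (gradient F (w k)) / (1 + b) \<le> norm (gradient F (w k)) / (1 + spectral_norm (B k))"
      using B[of k] spectral_norm_nonneg[of "B k"] by (intro divide_left_mono) auto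
    then have "\<xi> * norm (gradient F (w k)) * min (norm (gradient F (w k)) / (1 + b)) (\<Delta> k)
        \<le> \<xi> * norm (gradient F (w k))
            * min (norm (gradient F (w k)) / (1 + spectral_norm (B k))) (\<Delta> k)"
      using xi by (intro mult_left_mono min.mono) auto
    with sufficient_decrease[of k]
    show "\<xi> * norm (gradient F (w k)) * min (norm (gradient F (w k)) / (1 + b)) (\<Delta> k)
        \<le> quad_model F (B k) (w k) 0 - quad_model F (B k) (w k) (p k)"
      by linarith
    show "\<bar>F (w k) - F (w k + p k) - (quad_model F (B k) (w k) 0 - quad_model F (B k) (w k) (p k))\<bar>
        \<le> (L + b) * (norm (p k))\<^sup>2"
      by (rule quad_model_error_le[OF der lipschitz B])
  qed (use run bounded_below lipschitz xi eta1 eta13 eta23 zeta1 zeta2 L in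
      \<open>auto simp: slsr1_run_def Let_def reduction_ratio_def b_def\<close>)
  show ?thesis
    by (rule gradient_tendsto_zero)
qed

end
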